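(* Let $f:\mathbb{R}^n\to\mathbb{R}\cup\{\pm\infty\}$ be a function and $\bar x\in\mathbb{R}^n$ with $|f(\bar x)|<\infty$. Then $f^\downarrow(\bar x)>0$ if and only if $\mathbf{0}^*\in\mathrm{int}\,\hat\partial f(\bar x)$.
   Context: The steepest descent rate is $f^\downarrow(\bar x)=\liminf_{x\to\bar x}\frac{f(x)-f(\bar x)}{\|x-\bar x\|}$ (liminf over $x\neq\bar x$). $\hat\partial f(\bar x)=\left\{x^*\in(\mathbb{R}^n)^*:\ \liminf_{x\to\bar x}\frac{f(x)-f(\bar x)-\langle x^*,x-\bar x\rangle}{\|x-\bar x\|}\ge0\right\}$ is the regular (Fréchet) subdifferential of $f$ at $\bar x$; $\mathbf{0}^*$ is the null vector of the dual space $(\mathbb{R}^n)^*$. *)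

theory Defs
  imports "HOL-Analysis.Analysis"
begin

text \<open>
  Extended-real-valued functions have values in \<^typ>\<open>ereal\<close>. Both notions below are meant
  for points \<open>a\<close> at which \<open>f\<close> is finite; then no difference of the form
  \<open>\<infinity> - \<infinity>\<close> occurs in the quotients. The filter \<open>at a\<close> excludes the
  point \<open>a\<close> itself, so the denominators are positive. The dual space is the type of bounded
  linear functionals with the operator norm.
\<close>

definition steepest_descent_rate :: "('a::real_normed_vector \<Rightarrow> ereal) \<Rightarrow> 'a \<Rightarrow> ereal" where
  "steepest_descent_rate f a =
     Liminf (at a) (\<lambda>x. (f x - f a) / ereal (norm (x - a)))"

definition regular_subdifferential ::
    "('a::real_normed_vector \<Rightarrow> ereal) \<Rightarrow> 'a \<Rightarrow> ('a \<Rightarrow>\<^sub>L real) set" where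
  "regular_subdifferential f a =
     {u. Liminf (at a) (\<lambda>x. (f x - f a - ereal (blinfun_apply u (x - a))) / ereal (norm (x - a))) \<ge> 0}"

end

theory Submission
  imports Defs
begin

text \<open>
  Positivity of the descent rate means \<open>f x > f a + c * norm (x - a)\<close> near \<open>a\<close> for some
  \<open>c > 0\<close>, which makes every functional of norm less than \<open>c\<close> a regular subgradient.
  Conversely, if a small ball around \<open>0\<close> consists of subgradients, then so do the finitely many
  functionals \<open>\<plusminus>d * (b \<bullet> _)\<close> with \<open>b\<close> in the standard basis; each vector \<open>x - a\<close> has a coordinate
  of size at least \<open>norm (x - a) / DIM('a)\<close>, so the corresponding functional bounds the
  difference quotient of \<open>f\<close> away from \<open>0\<close>.
\<close>

text \<open>Clears the denominator in difference quotients. Only \<open>y\<close> may be infinite,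
  and then both sides have the same truth value; for real \<open>y\<close> this is real
  arithmetic.\<close>

lemma ereal_quotient_gt_iff:
  assumes "n > 0"
  shows "ereal c < (y - ereal r - ereal p) / ereal n \<longleftrightarrow> ereal (r + p + c * n) < y"
  using assms by (cases y) (auto simp: field_simps)

lemma eventually_ereal_quotient_gt_iff:
  fixes f :: "'a::real_normed_vector \<Rightarrow> ereal"
  assumes "f a = ereal r"
  shows "(\<forall>\<^sub>F x in at a. ereal c < (f x - f a - ereal (p x)) / ereal (norm (x - a))) \<longleftrightarrow>
    (\<forall>\<^sub>F x in at a. ereal (r + p x + c * norm (x - a)) < f x)"
  unfolding assms
  \<comment> \<open>The filter \<open>at a\<close> supplies \<open>x \<noteq> a\<close>, hence the
    positive denominator.\<close>
  by (intro eventually_cong[OF eventually_at_filter[THEN iffD2]] ereal_quotient_gt_iff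
      always_eventually) auto

text \<open>A real \<open>c\<close> strictly between \<open>0\<close> and the rate is eventually
  exceeded by the quotient; conversely, an eventual lower bound \<open>c\<close> also bounds the
  \<open>Liminf\<close>.\<close>

lemma steepest_descent_rate_pos_iff:
  fixes f :: "'a::real_normed_vector \<Rightarrow> ereal"
  assumes "f a = ereal r"
  shows "steepest_descent_rate f a > 0 \<longleftrightarrow>
    (\<exists>c>0. \<forall>\<^sub>F x in at a. ereal (r + c * norm (x - a)) < f x)"
proof -
  have "steepest_descent_rate f a > 0 \<longleftrightarrow>
    (\<exists>c>0. \<forall>\<^sub>F x in at a. ereal c < (f x - f a) / ereal (norm (x - a)))"
  proof
    assume "steepest_descent_rate f a > 0"
    then obtain c where c: "0 < ereal c" "ereal c < steepest_descent_rate f a"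
      using ereal_dense2 by blast
    then show "\<exists>c>0. \<forall>\<^sub>F x in at a. ereal c < (f x - f a) / ereal (norm (x - a))"
      unfolding steepest_descent_rate_def using less_LiminfD by force
  next
    assume "\<exists>c>0. \<forall>\<^sub>F x in at a. ereal c < (f x - f a) / ereal (norm (x - a))"
    then obtain c where c: "c > 0"
      and ev: "\<forall>\<^sub>F x in at a. ereal c < (f x - f a) / ereal (norm (x - a))" by blast
    have "ereal c \<le> steepest_descent_rate f a"
      unfolding steepest_descent_rate_def
      by (rule Liminf_bounded) (use ev in \<open>auto elim: eventually_mono\<close>)
    with c show "steepest_descent_rate f a > 0"
      by (meson ereal_less(2) order_less_le_trans)
  qed
  then show ?thesis
    using eventually_ereal_quotient_gt_iff[of f a r _ "\<lambda>_. 0"] assms by simp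
qed

lemma mem_regular_subdifferential_iff:
  fixes f :: "'a::real_normed_vector \<Rightarrow> ereal"
  assumes "f a = ereal r"
  shows "u \<in> regular_subdifferential f a \<longleftrightarrow>
    (\<forall>e>0. \<forall>\<^sub>F x in at a. ereal (r + blinfun_apply u (x - a) - e * norm (x - a)) < f x)"
proof -
  let ?q = "\<lambda>x. (f x - f a - ereal (blinfun_apply u (x - a))) / ereal (norm (x - a))"
  have "u \<in> regular_subdifferential f a \<longleftrightarrow> (\<forall>y<0. \<forall>\<^sub>F x in at a. y < ?q x)"
    by (simp add: regular_subdifferential_def le_Liminf_iff)
  also have "\<dots> \<longleftrightarrow> (\<forall>e>0. \<forall>\<^sub>F x in at a. ereal (- e) < ?q x)"
  proof (intro iffI allI impI)
    \<comment> \<open>A level \<open>y\<close> may be \<open>-\<infinity>\<close>, so a real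
      \<open>c\<close> between \<open>y\<close> and \<open>0\<close> replaces it, with
      \<open>e = - c\<close>.\<close>
    fix y :: ereal
    assume ev: "\<forall>e>0. \<forall>\<^sub>F x in at a. ereal (- e) < ?q x" and "y < 0"
    then obtain c where "y < ereal c" "ereal c < 0"
      using ereal_dense2 by blast
    then show "\<forall>\<^sub>F x in at a. y < ?q x"
      using ev[rule_format, of "- c"] by (auto elim: eventually_mono)
  qed auto
  also have "\<dots> \<longleftrightarrow> (\<forall>e>0. \<forall>\<^sub>F x in at a.
      ereal (r + blinfun_apply u (x - a) - e * norm (x - a)) < f x)"
    using eventually_ereal_quotient_gt_iff[of f a r _ "\<lambda>x. blinfun_apply u (x - a)"] assms by simp
  finally show ?thesis .
qed

text \<open>The operator norm bound gives
  \<open>blinfun_apply u (x - a) \<le> c * norm (x - a)\<close>, so the growth of \<open>f\<close>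
  dominates the linear term.\<close>

lemma ball_subset_regular_subdifferential:
  fixes f :: "'a::real_normed_vector \<Rightarrow> ereal"
  assumes fa: "f a = ereal r"
    and ev: "\<forall>\<^sub>F x in at a. ereal (r + c * norm (x - a)) < f x"
  shows "ball 0 c \<subseteq> regular_subdifferential f a"
proof
  fix u :: "'a \<Rightarrow>\<^sub>L real"
  assume "u \<in> ball 0 c"
  then have u: "norm u \<le> c" by simp
  show "u \<in> regular_subdifferential f a"
    unfolding mem_regular_subdifferential_iff[of f, OF fa]
  proof (intro allI impI)
    fix e :: real
    assume "e > 0"
    have "r + blinfun_apply u (x - a) - e * norm (x - a) \<le> r + c * norm (x - a)" for x
    proof -
      have "blinfun_apply u (x - a) \<le> norm u * norm (x - a)"
        using norm_blinfun[of u "x - a"] by simp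
      also have "\<dots> \<le> c * norm (x - a)"
        using u by (simp add: mult_right_mono)
      finally show ?thesis
        using \<open>e > 0\<close> by (smt (verit) mult_nonneg_nonneg norm_ge_zero)
    qed
    then show "\<forall>\<^sub>F x in at a. ereal (r + blinfun_apply u (x - a) - e * norm (x - a)) < f x"
      using ev by (elim eventually_mono) (meson ereal_less_eq(3) order_le_less_trans)
  qed
qed

text \<open>If all coordinates were smaller, the sum of their absolute values would be less than
  \<open>norm v\<close>, contradicting \<open>norm_le_l1\<close>.\<close>

lemma exists_Basis_norm_le:
  fixes v :: "'a::euclidean_space"
  shows "\<exists>b\<in>Basis. norm v \<le> DIM('a) * \<bar>v \<bullet> b\<bar>"
proof (rule ccontr)
  assume "\<not> ?thesis"
  then have "\<bar>v \<bullet> b\<bar> < norm v / DIM('a)" if "b \<in> Basis" for b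
    using that by (auto simp: field_simps not_le)
  then have "(\<Sum>b\<in>Basis. \<bar>v \<bullet> b\<bar>) < (\<Sum>b\<in>(Basis::'a set). norm v / DIM('a))"
    by (intro sum_strict_mono) auto
  then show False
    using norm_le_l1[of v] by simp
qed

lemma growth_of_ball_subset_regular_subdifferential:
  fixes f :: "'a::euclidean_space \<Rightarrow> ereal"
  assumes fa: "f a = ereal r" and "e > 0"
    and sub: "ball 0 e \<subseteq> regular_subdifferential f a"
  shows "\<exists>c>0. \<forall>\<^sub>F x in at a. ereal (r + c * norm (x - a)) < f x"
proof (intro exI conjI)
  \<comment> \<open>Halving keeps functionals of norm at most \<open>d\<close> inside the open ball
    of radius \<open>e\<close>.\<close>
  define d where "d = e / 2"
  \<comment> \<open>With this \<open>c\<close>, a largest coordinate contributes at least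
    \<open>2 * c * norm (x - a)\<close>: one half absorbs the subgradient error, the other is the
    growth.\<close>
  define c where "c = d / (2 * DIM('a))"
  have d: "0 < d" "d < e" using \<open>e > 0\<close> by (auto simp: d_def)
  show c: "c > 0" using d by (simp add: c_def)
  have "\<forall>\<^sub>F x in at a. ereal (r + s * d * (b \<bullet> (x - a)) - c * norm (x - a)) < f x"
    if b: "b \<in> Basis" and s: "s \<in> {-1, 1}" for b s
  proof -
    let ?u = "(s * d) *\<^sub>R blinfun_inner_left b"
    have "norm (blinfun_inner_left b) \<le> 1"
      by (rule norm_blinfun_bound) (use b in \<open>simp_all add: Basis_le_norm inner_commute\<close>)
    then have "norm ?u \<le> d"
      using s d by (auto simp: mult_left_le)
    then have "?u \<in> regular_subdifferential f a"
      using sub d by auto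
    then show ?thesis
      using c by (simp add: mem_regular_subdifferential_iff[of f, OF fa]
          scaleR_blinfun.rep_eq inner_commute)
  qed
  then have "\<forall>\<^sub>F x in at a. \<forall>b\<in>Basis. \<forall>s\<in>{-1, 1}.
      ereal (r + s * d * (b \<bullet> (x - a)) - c * norm (x - a)) < f x"
    \<comment> \<open>Finitely many pairs \<open>(b, s)\<close> allow one common neighbourhood,
      needed because \<open>b\<close> and \<open>s\<close> are chosen below depending on
      \<open>x\<close>.\<close>
    by (intro eventually_ball_finite ballI) auto
  then show "\<forall>\<^sub>F x in at a. ereal (r + c * norm (x - a)) < f x"
  proof (rule eventually_mono)
    fix x
    assume ev: "\<forall>b\<in>Basis. \<forall>s\<in>{-1, 1}.
      ereal (r + s * d * (b \<bullet> (x - a)) - c * norm (x - a)) < f x"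
    obtain b where b: "b \<in> Basis" "norm (x - a) \<le> DIM('a) * \<bar>(x - a) \<bullet> b\<bar>"
      using exists_Basis_norm_le by blast
    \<comment> \<open>This sign turns \<open>s * (b \<bullet> (x - a))\<close> into the absolute
      value of the coordinate.\<close>
    define s :: real where "s = (if b \<bullet> (x - a) \<ge> 0 then 1 else - 1)"
    have "2 * c * norm (x - a) \<le> 2 * c * (DIM('a) * \<bar>(x - a) \<bullet> b\<bar>)"
      using b c by (intro mult_left_mono) auto
    also have "\<dots> = d * \<bar>(x - a) \<bullet> b\<bar>"
      by (simp add: c_def)
    also have "\<dots> = s * d * (b \<bullet> (x - a))"
      by (simp add: s_def inner_commute)
    finally have "r + c * norm (x - a) \<le> r + s * d * (b \<bullet> (x - a)) - c * norm (x - a)"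
      by linarith
    moreover have "ereal (r + s * d * (b \<bullet> (x - a)) - c * norm (x - a)) < f x"
      using ev b(1) by (simp add: s_def)
    ultimately show "ereal (r + c * norm (x - a)) < f x"
      by (meson ereal_less_eq(3) order_le_less_trans)
  qed
qed

theorem theorem4:
  fixes f :: "real ^ 'n \<Rightarrow> ereal" and xbar :: "real ^ 'n"
  assumes "\<bar>f xbar\<bar> < \<infinity>"
  shows "steepest_descent_rate f xbar > 0 \<longleftrightarrow> 0 \<in> interior (regular_subdifferential f xbar)"
proof -
  obtain r where r: "f xbar = ereal r"
    using assms by (cases "f xbar") auto
  show ?thesis
    unfolding steepest_descent_rate_pos_iff[of f, OF r] mem_interior
    using ball_subset_regular_subdifferential[of f, OF r]
      growth_of_ball_subset_regular_subdifferential[of f, OF r] by meson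
qed

end
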